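(* Let $U$ be a set and $X$ a Banach space. Let $\mathcal{F}_1$ and $\mathcal{F}_2$ be two closed vector subspaces of $B(U,X)$ satisfying the following hypotheses: (i) whenever $\Phi : X \to X$ is a Lipschitz map and $f \in \mathcal{F}_1$, then $\Phi \circ f \in \mathcal{F}_1$; (ii) whenever $g \in \mathcal{F}_1$ and $h \in \mathcal{F}_2$ are such that $\Vert g(u) \Vert \leq \Vert h(u) \Vert$ for all $u \in U$, then $g \in \mathcal{F}_2$. Then $\mathcal{F}_1 + \mathcal{F}_2$ is a Banach space when endowed with the norm $\Vert \cdot \Vert_{\infty}$.
   Context: $B(U,X)$ denotes the Banach space of all bounded functions from $U$ into $X$, equipped with the norm $\Vert f \Vert_{\infty} = \sup_{u \in U} \Vert f(u) \Vert$. $\mathcal{F}_1+\mathcal{F}_2 = \{g+h : g\in\mathcal{F}_1,\ h\in\mathcal{F}_2\}$ (the sum need not be direct). *)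

theory Defs
  imports "HOL-Analysis.Analysis"
begin

text \<open>Functions on a set \<open>U\<close> are represented by the members of \<open>extensional U\<close>, so the
  operations on them are restricted to \<open>U\<close>.\<close>

definition bfun :: "'u set \<Rightarrow> ('u \<Rightarrow> 'x::real_normed_vector) set" where
  "bfun U = {f \<in> extensional U. bounded (f ` U)}"

definition bfun_zero :: "'u set \<Rightarrow> 'u \<Rightarrow> 'x::real_normed_vector" where
  "bfun_zero U = (\<lambda>u\<in>U. 0)"

definition bfun_add :: "'u set \<Rightarrow> ('u \<Rightarrow> 'x::real_normed_vector) \<Rightarrow> ('u \<Rightarrow> 'x) \<Rightarrow> 'u \<Rightarrow> 'x" where
  "bfun_add U f g = (\<lambda>u\<in>U. f u + g u)"

definition bfun_scale ::
  "('k \<Rightarrow> 'x \<Rightarrow> 'x) \<Rightarrow> 'u set \<Rightarrow> 'k \<Rightarrow> ('u \<Rightarrow> 'x::real_normed_vector) \<Rightarrow> 'u \<Rightarrow> 'x" where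
  "bfun_scale smul U a f = (\<lambda>u\<in>U. smul a (f u))"

text \<open>The supremum of the empty set of reals is unspecified; inserting \<open>0\<close> makes the norm
  vanish when \<open>U\<close> is empty and changes nothing otherwise.\<close>

definition sup_norm :: "'u set \<Rightarrow> ('u \<Rightarrow> 'x::real_normed_vector) \<Rightarrow> real" where
  "sup_norm U f = Sup (insert 0 ((\<lambda>u. norm (f u)) ` U))"

text \<open>\<open>Metric_space\<close> demands a nonnegative symmetric distance even outside the carrier, hence the
  default value.\<close>

definition norm_dist ::
  "'v set \<Rightarrow> ('v \<Rightarrow> 'v \<Rightarrow> 'v) \<Rightarrow> ('v \<Rightarrow> real) \<Rightarrow> 'v \<Rightarrow> 'v \<Rightarrow> real" where
  "norm_dist V sub nrm x y = (if x \<in> V \<and> y \<in> V then nrm (sub x y) else 0)"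

definition sup_dist :: "'u set \<Rightarrow> ('u \<Rightarrow> 'x::real_normed_vector) \<Rightarrow> ('u \<Rightarrow> 'x) \<Rightarrow> real" where
  "sup_dist U = norm_dist (bfun U) (\<lambda>f g. \<lambda>u\<in>U. f u - g u) (sup_norm U)"

definition closed_vector_subspace ::
  "('k \<Rightarrow> 'x \<Rightarrow> 'x) \<Rightarrow> 'u set \<Rightarrow> ('u \<Rightarrow> 'x::real_normed_vector) set \<Rightarrow> bool" where
  "closed_vector_subspace smul U F \<longleftrightarrow>
     F \<subseteq> bfun U \<and>
     bfun_zero U \<in> F \<and>
     (\<forall>f\<in>F. \<forall>g\<in>F. bfun_add U f g \<in> F) \<and>
     (\<forall>a. \<forall>f\<in>F. bfun_scale smul U a f \<in> F) \<and>
     closedin (Metric_space.mtopology (bfun U) (sup_dist U)) F"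

definition bfun_set_sum ::
  "'u set \<Rightarrow> ('u \<Rightarrow> 'x::real_normed_vector) set \<Rightarrow> ('u \<Rightarrow> 'x) set \<Rightarrow> ('u \<Rightarrow> 'x) set" where
  "bfun_set_sum U F G = {bfun_add U g h | g h. g \<in> F \<and> h \<in> G}"

text \<open>The real normed fields are, up to isometric isomorphism, \<open>\<real>\<close> and \<open>\<complex>\<close>, so a scalar type of
  class \<open>real_normed_field\<close> covers real and complex spaces alike.\<close>

locale banach_space_on =
  fixes V :: "'v set"
    and add :: "'v \<Rightarrow> 'v \<Rightarrow> 'v"
    and zero :: 'v
    and smul :: "'k::real_normed_field \<Rightarrow> 'v \<Rightarrow> 'v"
    and nrm :: "'v \<Rightarrow> real"
  assumes zero_closed: "zero \<in> V"
    and add_closed: "x \<in> V \<Longrightarrow> y \<in> V \<Longrightarrow> add x y \<in> V"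
    and scale_closed: "x \<in> V \<Longrightarrow> smul a x \<in> V"
    and add_assoc: "x \<in> V \<Longrightarrow> y \<in> V \<Longrightarrow> z \<in> V \<Longrightarrow> add (add x y) z = add x (add y z)"
    and add_commute: "x \<in> V \<Longrightarrow> y \<in> V \<Longrightarrow> add x y = add y x"
    and add_zero: "x \<in> V \<Longrightarrow> add x zero = x"
    and add_inverse: "x \<in> V \<Longrightarrow> \<exists>y\<in>V. add x y = zero"
    and scale_add_right: "x \<in> V \<Longrightarrow> y \<in> V \<Longrightarrow> smul a (add x y) = add (smul a x) (smul a y)"
    and scale_add_left: "x \<in> V \<Longrightarrow> smul (a + b) x = add (smul a x) (smul b x)"
    and scale_scale: "x \<in> V \<Longrightarrow> smul a (smul b x) = smul (a * b) x"
    and scale_one: "x \<in> V \<Longrightarrow> smul 1 x = x"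
    and nrm_nonneg: "x \<in> V \<Longrightarrow> 0 \<le> nrm x"
    and nrm_eq_zero: "x \<in> V \<Longrightarrow> nrm x = 0 \<longleftrightarrow> x = zero"
    and nrm_triangle: "x \<in> V \<Longrightarrow> y \<in> V \<Longrightarrow> nrm (add x y) \<le> nrm x + nrm y"
    and nrm_scale: "x \<in> V \<Longrightarrow> nrm (smul a x) = norm a * nrm x"
    and complete: "Metric_space.mcomplete V (norm_dist V (\<lambda>x y. add x (smul (- 1) y)) nrm)"

end

theory Submission
  imports Defs
begin

text \<open>The point is that every \<open>f \<in> F1 + F2\<close> has a decomposition \<open>f = g' + h'\<close> with
  \<open>\<parallel>g'\<parallel> \<le> \<parallel>f\<parallel>\<close>. Start from any \<open>f = g + h\<close> and let \<open>g'\<close> be \<open>g\<close> followed by the radial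
  retraction onto the ball of radius \<open>\<parallel>f\<parallel>\<close>, a Lipschitz map. Then \<open>g - g'\<close> lies in \<open>F1\<close>, and
  its norm at \<open>u\<close> is \<open>max 0 (norm (g u) - \<parallel>f\<parallel>) \<le> norm (h u)\<close>, so it lies in \<open>F2\<close> and can be
  moved to the second summand. Applied to the increments of a rapidly Cauchy sequence, this
  yields a uniformly convergent sequence of first components.\<close>

section \<open>The radial retraction onto a ball\<close>

definition radial_retraction :: "real \<Rightarrow> 'a::real_normed_vector \<Rightarrow> 'a" where
  "radial_retraction M x = (if norm x \<le> M then x else (M / norm x) *\<^sub>R x)"

lemma norm_radial_retraction_le:
  assumes "0 \<le> M"
  shows "norm (radial_retraction M x) \<le> M"
  using assms by (auto simp: radial_retraction_def)

text \<open>A point outside the ball moves along its ray, exactly by the excess of its norm over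
  \<open>M\<close>. This exact value is what the domination hypothesis is later tested
  against.\<close>

lemma norm_diff_radial_retraction:
  assumes "0 \<le> M"
  shows "norm (x - radial_retraction M x) = max 0 (norm x - M)"
proof (cases "norm x \<le> M")
  case True
  then show ?thesis by (simp add: radial_retraction_def)
next
  case False
  with assms have pos: "0 < norm x" by linarith
  have "x - (M / norm x) *\<^sub>R x = (1 - M / norm x) *\<^sub>R x"
    by (simp add: scaleR_left_diff_distrib)
  moreover have "M / norm x \<le> 1"
    using False pos by simp
  ultimately have "norm (x - (M / norm x) *\<^sub>R x) = (1 - M / norm x) * norm x"
    by simp
  also have "\<dots> = norm x - M"
    using pos by (simp add: field_simps)
  finally show ?thesis
    using False by (simp add: radial_retraction_def)
qed

text \<open>One factor \<open>norm (x - y)\<close> pays for the change of direction and another for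
  the change of length, whence the constant 2 in an arbitrary normed space.\<close>

lemma lipschitz_on_radial_retraction:
  assumes M: "0 \<le> M"
  shows "2-lipschitz_on UNIV (radial_retraction M :: 'a::real_normed_vector \<Rightarrow> 'a)"
proof -
  have le: "norm (radial_retraction M x - radial_retraction M y) \<le> 2 * norm (x - y)"
    if xy: "norm x \<le> norm y" for x y :: 'a
  proof -
    have tri: "norm y - norm x \<le> norm (x - y)"
      by (metis norm_minus_commute norm_triangle_ineq2)
    \<comment> \<open>Since \<open>norm x \<le> norm y\<close>, the cases are: both points in the
      ball, only \<open>y\<close> outside, both outside.\<close>
    consider "norm y \<le> M" | "norm x \<le> M" "M < norm y" | "M < norm x"
      by linarith
    then show ?thesis
    proof cases
      case 1
      with xy show ?thesis by (simp add: radial_retraction_def)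
    next
      case 2
      \<comment> \<open>Here \<open>x\<close> is fixed and \<open>y\<close> moves by
        \<open>norm y - M\<close>, which is at most \<open>norm y - norm x\<close> and hence at most
        \<open>norm (x - y)\<close>.\<close>
      have "norm (radial_retraction M x - radial_retraction M y)
          = norm ((x - y) + (y - radial_retraction M y))"
        using 2 by (simp add: radial_retraction_def)
      also have "\<dots> \<le> norm (x - y) + norm (y - radial_retraction M y)"
        by (rule norm_triangle_ineq)
      also have "norm (y - radial_retraction M y) = norm y - M"
        using 2 by (simp add: norm_diff_radial_retraction[OF M])
      finally show ?thesis
        using tri 2 by linarith
    next
      case 3
      with M xy have pos: "0 < norm x" "0 < norm y" by linarith+
      \<comment> \<open>Inserting \<open>(M / norm y) *\<^sub>R x\<close> separates the difference
        of the points from the difference of the scaling factors. Both resulting norms carry the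
        factor \<open>M / norm y\<close>, which is below 1.\<close>
      have "radial_retraction M x - radial_retraction M y
          = (M / norm y) *\<^sub>R (x - y) + (M / norm x - M / norm y) *\<^sub>R x"
        using 3 xy by (simp add: radial_retraction_def algebra_simps)
      then have "norm (radial_retraction M x - radial_retraction M y)
          \<le> norm ((M / norm y) *\<^sub>R (x - y)) + norm ((M / norm x - M / norm y) *\<^sub>R x)"
        by (metis norm_triangle_ineq)
      also have "norm ((M / norm x - M / norm y) *\<^sub>R x) = M / norm y * (norm y - norm x)"
      proof -
        have "M / norm x - M / norm y \<ge> 0"
          using pos xy M by (simp add: frac_le)
        then show ?thesis
          using pos by (simp add: field_simps)
      qed
      also have "norm ((M / norm y) *\<^sub>R (x - y)) = M / norm y * norm (x - y)"
        using M by simp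
      also have "M / norm y * norm (x - y) + M / norm y * (norm y - norm x)
          = M / norm y * (norm (x - y) + (norm y - norm x))"
        by (simp add: algebra_simps)
      also have "\<dots> \<le> 1 * (norm (x - y) + (norm y - norm x))"
        using 3 xy M pos by (intro mult_right_mono) auto
      also have "\<dots> \<le> 2 * norm (x - y)"
        using tri by simp
      finally show ?thesis .
    qed
  qed
  show ?thesis
  proof (rule lipschitz_onI)
    fix x y :: 'a
    show "dist (radial_retraction M x) (radial_retraction M y) \<le> 2 * dist x y"
      using le[of x y] le[of y x] by (cases "norm x \<le> norm y") (auto simp: dist_norm norm_minus_commute)
  qed simp
qed

section \<open>Bounded functions and the supremum norm\<close>

definition bfun_diff ::
  "'u set \<Rightarrow> ('u \<Rightarrow> 'x::real_normed_vector) \<Rightarrow> ('u \<Rightarrow> 'x) \<Rightarrow> 'u \<Rightarrow> 'x" where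
  "bfun_diff U f g = (\<lambda>u\<in>U. f u - g u)"

lemma bfun_app [simp]:
  assumes "u \<in> U"
  shows "bfun_zero U u = 0" "bfun_add U f g u = f u + g u" "bfun_diff U f g u = f u - g u"
    "bfun_scale smul U a f u = smul a (f u)"
  using assms by (simp_all add: bfun_zero_def bfun_add_def bfun_diff_def bfun_scale_def)

lemma bfun_ext [simp]:
  "bfun_zero U \<in> extensional U" "bfun_add U f g \<in> extensional U"
  "bfun_diff U f g \<in> extensional U" "bfun_scale smul U a f \<in> extensional U"
  by (simp_all add: bfun_zero_def bfun_add_def bfun_diff_def bfun_scale_def)

lemma mem_bfun_iff: "f \<in> bfun U \<longleftrightarrow> f \<in> extensional U \<and> (\<exists>B. \<forall>u\<in>U. norm (f u) \<le> B)"
  by (auto simp: bfun_def bounded_iff)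

lemma bfun_add_mem:
  assumes "f \<in> bfun U" "g \<in> bfun U"
  shows "bfun_add U f g \<in> bfun U"
  using assms by (auto simp: mem_bfun_iff intro: norm_triangle_mono)

lemma bfun_diff_mem:
  assumes "f \<in> bfun U" "g \<in> bfun U"
  shows "bfun_diff U f g \<in> bfun U"
  using assms unfolding mem_bfun_iff by (auto) (meson norm_triangle_le_diff add_mono)

lemma bdd_above_norms:
  assumes "f \<in> bfun U"
  shows "bdd_above (insert 0 ((\<lambda>u. norm (f u)) ` U))"
  using assms by (auto simp: mem_bfun_iff intro: bdd_aboveI2)

lemma norm_le_sup_norm:
  assumes "f \<in> bfun U" "u \<in> U"
  shows "norm (f u) \<le> sup_norm U f"
  unfolding sup_norm_def using assms by (intro cSup_upper bdd_above_norms) auto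

lemma sup_norm_le:
  assumes "0 \<le> c" "\<And>u. u \<in> U \<Longrightarrow> norm (f u) \<le> c"
  shows "sup_norm U f \<le> c"
  unfolding sup_norm_def using assms by (auto intro: cSup_least)

lemma sup_norm_nonneg:
  assumes "f \<in> bfun U"
  shows "0 \<le> sup_norm U f"
  unfolding sup_norm_def using assms by (intro cSup_upper bdd_above_norms) auto

lemma sup_norm_eq_0_iff:
  assumes "f \<in> bfun U"
  shows "sup_norm U f = 0 \<longleftrightarrow> f = bfun_zero U"
proof
  assume "sup_norm U f = 0"
  then show "f = bfun_zero U"
    using norm_le_sup_norm[OF assms] assms by (intro extensionalityI[of _ U]) (auto simp: bfun_def)
next
  assume "f = bfun_zero U"
  then have "sup_norm U f \<le> 0" by (intro sup_norm_le) auto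
  with sup_norm_nonneg[OF assms] show "sup_norm U f = 0" by simp
qed

lemma sup_norm_triangle:
  assumes "f \<in> bfun U" "g \<in> bfun U"
  shows "sup_norm U (bfun_add U f g) \<le> sup_norm U f + sup_norm U g"
  using assms
  by (intro sup_norm_le) (auto intro: norm_triangle_mono norm_le_sup_norm simp: sup_norm_nonneg)

lemma bfun_scale_mem:
  fixes smul :: "'k::real_normed_field \<Rightarrow> 'x::real_normed_vector \<Rightarrow> 'x"
  assumes "\<And>a x. norm (smul a x) = norm a * norm x" "f \<in> bfun U"
  shows "bfun_scale smul U a f \<in> bfun U"
proof -
  obtain B where "\<And>u. u \<in> U \<Longrightarrow> norm (f u) \<le> B"
    using assms(2) by (auto simp: mem_bfun_iff)
  then have "\<forall>u\<in>U. norm (bfun_scale smul U a f u) \<le> norm a * B"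
    by (simp add: assms(1) mult_left_mono)
  then show ?thesis by (auto simp only: mem_bfun_iff bfun_ext)
qed

lemma sup_norm_scale:
  fixes smul :: "'k::real_normed_field \<Rightarrow> 'x::real_normed_vector \<Rightarrow> 'x"
  assumes smul: "\<And>a x. norm (smul a x) = norm a * norm x" and f: "f \<in> bfun U"
  shows "sup_norm U (bfun_scale smul U a f) = norm a * sup_norm U f"
proof (rule antisym)
  show "sup_norm U (bfun_scale smul U a f) \<le> norm a * sup_norm U f"
    by (intro sup_norm_le)
      (simp_all add: smul f sup_norm_nonneg mult_left_mono norm_le_sup_norm)
  show "norm a * sup_norm U f \<le> sup_norm U (bfun_scale smul U a f)"
  proof (cases "a = 0")
    case False
    \<comment> \<open>The supremum is bounded pointwise after division by
      \<open>norm a\<close>.\<close>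
    have "sup_norm U f \<le> sup_norm U (bfun_scale smul U a f) / norm a"
    proof (rule sup_norm_le)
      fix u assume u: "u \<in> U"
      show "norm (f u) \<le> sup_norm U (bfun_scale smul U a f) / norm a"
        using norm_le_sup_norm[OF bfun_scale_mem[OF smul f] u, of a] u False
        by (simp add: smul field_simps)
    qed (simp add: sup_norm_nonneg[OF bfun_scale_mem[OF smul f]])
    with False show ?thesis by (simp add: field_simps)
  qed (simp add: sup_norm_nonneg[OF bfun_scale_mem[OF smul f]])
qed

section \<open>The supremum metric and uniform convergence\<close>

lemma Metric_space_sup_norm:
  assumes "V \<subseteq> bfun U"
  shows "Metric_space V (norm_dist V (bfun_diff U) (sup_norm U))"
proof
  fix f g h
  show "0 \<le> norm_dist V (bfun_diff U) (sup_norm U) f g"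
    using assms by (auto simp: norm_dist_def intro!: sup_norm_nonneg bfun_diff_mem)
  show "norm_dist V (bfun_diff U) (sup_norm U) f g = norm_dist V (bfun_diff U) (sup_norm U) g f"
    by (auto simp: norm_dist_def sup_norm_def norm_minus_commute)
  assume f: "f \<in> V" and g: "g \<in> V"
  have "bfun_diff U f g = bfun_zero U \<longleftrightarrow> f = g"
  proof
    assume *: "bfun_diff U f g = bfun_zero U"
    show "f = g"
    proof (rule extensionalityI)
      fix u assume "u \<in> U"
      then show "f u = g u" using fun_cong[OF *, of u] by simp
    qed (use f g assms in \<open>auto simp: bfun_def\<close>)
  qed (auto simp: bfun_diff_def bfun_zero_def)
  then show "norm_dist V (bfun_diff U) (sup_norm U) f g = 0 \<longleftrightarrow> f = g"
    using f g assms by (auto simp: norm_dist_def sup_norm_eq_0_iff bfun_diff_mem subset_iff)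
  assume h: "h \<in> V"
  have "bfun_diff U f h = bfun_add U (bfun_diff U f g) (bfun_diff U g h)"
    by (rule extensionalityI[of _ U]) auto
  then show "norm_dist V (bfun_diff U) (sup_norm U) f h
      \<le> norm_dist V (bfun_diff U) (sup_norm U) f g + norm_dist V (bfun_diff U) (sup_norm U) g h"
    using f g h assms by (auto simp: norm_dist_def subset_iff intro!: sup_norm_triangle bfun_diff_mem)
qed

lemma sup_dist_eq: "sup_dist U = norm_dist (bfun U) (bfun_diff U) (sup_norm U)"
  by (simp add: sup_dist_def bfun_diff_def[abs_def])

lemma limitin_if_uniform_limit:
  assumes V: "V \<subseteq> bfun U" and \<sigma>: "\<And>n. \<sigma> n \<in> V" and l: "l \<in> V"
    and lim: "uniform_limit U \<sigma> l sequentially"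
  shows "limitin (Metric_space.mtopology V (norm_dist V (bfun_diff U) (sup_norm U))) \<sigma> l sequentially"
proof -
  interpret Metric_space V "norm_dist V (bfun_diff U) (sup_norm U)"
    using V by (rule Metric_space_sup_norm)
  show ?thesis
    unfolding limit_metric_sequentially
  proof (intro conjI allI impI)
    fix e :: real assume e: "0 < e"
    \<comment> \<open>A strict pointwise bound gives only a weak bound on the supremum; halving
      \<open>e\<close> restores strictness.\<close>
    then obtain N where N: "\<And>n u. N \<le> n \<Longrightarrow> u \<in> U \<Longrightarrow> dist (\<sigma> n u) (l u) < e / 2"
      using lim unfolding uniform_limit_sequentially_iff by (meson half_gt_zero)
    have "norm_dist V (bfun_diff U) (sup_norm U) (\<sigma> n) l < e" if "N \<le> n" for n
    proof -
      have "sup_norm U (bfun_diff U (\<sigma> n) l) \<le> e / 2"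
        using N[OF that] e by (intro sup_norm_le) (auto simp: dist_norm less_imp_le)
      with e \<sigma> l show ?thesis by (simp add: norm_dist_def)
    qed
    with \<sigma> show "\<exists>N. \<forall>n\<ge>N. \<sigma> n \<in> V \<and> norm_dist V (bfun_diff U) (sup_norm U) (\<sigma> n) l < e"
      by blast
  qed (rule l)
qed

lemma bfun_uniform_limit_mem:
  assumes \<sigma>: "\<And>n. \<sigma> n \<in> bfun U" and l: "l \<in> extensional U"
    and lim: "uniform_limit U \<sigma> l sequentially"
  shows "l \<in> bfun U"
proof -
  \<comment> \<open>A single bounded \<open>\<sigma> N\<close> within distance 1 of \<open>l\<close>
    already bounds \<open>l\<close>.\<close>
  obtain N where N: "\<And>u. u \<in> U \<Longrightarrow> dist (\<sigma> N u) (l u) < 1"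
    using lim unfolding uniform_limit_sequentially_iff by (metis order_refl zero_less_one)
  have "norm (l u) \<le> sup_norm U (\<sigma> N) + 1" if "u \<in> U" for u
  proof -
    have "norm (l u) \<le> norm (\<sigma> N u) + norm (l u - \<sigma> N u)"
      by (rule norm_triangle_sub)
    then show ?thesis
      using N[OF that] norm_le_sup_norm[OF \<sigma> that, of N] by (simp add: dist_norm norm_minus_commute)
  qed
  with l show ?thesis by (auto simp: mem_bfun_iff)
qed

text \<open>Turns topological closedness in the ambient space into closure under uniform limits.
  Uniform convergence on \<open>U\<close> says nothing about values off \<open>U\<close>, so
  \<open>l\<close> has to be extensional for the limit to be determined.\<close>

lemma closedin_uniform_limit_mem:
  assumes F: "closedin (Metric_space.mtopology (bfun U) (sup_dist U)) F"
    and \<sigma>: "\<And>n. \<sigma> n \<in> F" and l: "l \<in> extensional U"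
    and lim: "uniform_limit U \<sigma> l sequentially"
  shows "l \<in> F"
proof -
  interpret Metric_space "bfun U" "sup_dist U"
    unfolding sup_dist_eq by (rule Metric_space_sup_norm) simp
  have "F \<subseteq> bfun U"
    and seq: "\<And>\<sigma> l. range \<sigma> \<subseteq> F \<Longrightarrow> limitin mtopology \<sigma> l sequentially \<Longrightarrow> l \<in> F"
    using F unfolding metric_closedin_iff_sequentially_closed by blast+
  with \<sigma> have \<sigma>': "\<sigma> n \<in> bfun U" for n by blast
  have "limitin mtopology \<sigma> l sequentially"
    unfolding sup_dist_eq
    using \<sigma>' bfun_uniform_limit_mem[OF \<sigma>' l lim] lim by (intro limitin_if_uniform_limit) auto
  with \<sigma> show ?thesis by (intro seq) auto
qed

lemma uniformly_Cauchy_on_if_MCauchy: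
  assumes V: "V \<subseteq> bfun U"
    and \<sigma>: "Metric_space.MCauchy V (norm_dist V (bfun_diff U) (sup_norm U)) \<sigma>"
  shows "uniformly_Cauchy_on U \<sigma>"
proof (rule uniformly_Cauchy_onI)
  fix e :: real assume "0 < e"
  interpret Metric_space V "norm_dist V (bfun_diff U) (sup_norm U)"
    using V by (rule Metric_space_sup_norm)
  have mem: "\<sigma> n \<in> V" for n
    using \<sigma> unfolding MCauchy_def by blast
  obtain N where N: "\<And>m n. N \<le> m \<Longrightarrow> N \<le> n \<Longrightarrow>
      norm_dist V (bfun_diff U) (sup_norm U) (\<sigma> m) (\<sigma> n) < e"
    using \<sigma> \<open>0 < e\<close> unfolding MCauchy_def by meson
  have "dist (\<sigma> m u) (\<sigma> n u) < e" if "u \<in> U" "N \<le> m" "N \<le> n" for u m n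
  proof -
    have "norm (bfun_diff U (\<sigma> m) (\<sigma> n) u) \<le> sup_norm U (bfun_diff U (\<sigma> m) (\<sigma> n))"
      using mem V that by (intro norm_le_sup_norm bfun_diff_mem) auto
    then show ?thesis
      using N[OF that(2,3)] that(1) mem by (simp add: norm_dist_def dist_norm)
  qed
  then show "\<exists>N. \<forall>u\<in>U. \<forall>m\<ge>N. \<forall>n\<ge>N. dist (\<sigma> m u) (\<sigma> n u) < e" by blast
qed

section \<open>Controlled decompositions and completeness of the sum\<close>

locale two_subspaces =
  fixes U :: "'u set" and F1 F2 :: "('u \<Rightarrow> 'x::banach) set"
  assumes F1_bfun: "F1 \<subseteq> bfun U" and F2_bfun: "F2 \<subseteq> bfun U"
    and F1_add: "f \<in> F1 \<Longrightarrow> g \<in> F1 \<Longrightarrow> bfun_add U f g \<in> F1"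
    and F2_add: "f \<in> F2 \<Longrightarrow> g \<in> F2 \<Longrightarrow> bfun_add U f g \<in> F2"
    and F1_diff: "f \<in> F1 \<Longrightarrow> g \<in> F1 \<Longrightarrow> bfun_diff U f g \<in> F1"
    and F2_diff: "f \<in> F2 \<Longrightarrow> g \<in> F2 \<Longrightarrow> bfun_diff U f g \<in> F2"
    and F1_closed: "closedin (Metric_space.mtopology (bfun U) (sup_dist U)) F1"
    and F2_closed: "closedin (Metric_space.mtopology (bfun U) (sup_dist U)) F2"
    and F1_compose: "L-lipschitz_on UNIV \<Phi> \<Longrightarrow> f \<in> F1 \<Longrightarrow> compose U \<Phi> f \<in> F1"
    and dominated: "g \<in> F1 \<Longrightarrow> h \<in> F2 \<Longrightarrow> (\<And>u. u \<in> U \<Longrightarrow> norm (g u) \<le> norm (h u)) \<Longrightarrow> g \<in> F2"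
begin

lemma set_sum_bfun: "bfun_set_sum U F1 F2 \<subseteq> bfun U"
  using F1_bfun F2_bfun by (auto simp: bfun_set_sum_def intro!: bfun_add_mem)

lemma set_sum_diff:
  assumes "f \<in> bfun_set_sum U F1 F2" "f' \<in> bfun_set_sum U F1 F2"
  shows "bfun_diff U f f' \<in> bfun_set_sum U F1 F2"
proof -
  obtain g h g' h' where *: "g \<in> F1" "h \<in> F2" "g' \<in> F1" "h' \<in> F2"
    and ff: "f = bfun_add U g h" "f' = bfun_add U g' h'"
    using assms by (auto simp: bfun_set_sum_def)
  have "bfun_diff U f f' = bfun_add U (bfun_diff U g g') (bfun_diff U h h')"
    unfolding ff by (rule extensionalityI[of _ U]) auto
  with * show ?thesis
    by (auto simp: bfun_set_sum_def intro: F1_diff F2_diff)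
qed

text \<open>Any pointwise bound \<open>M\<close> on \<open>f\<close> may serve as the radius, so
  geometric bounds on increments pass directly to their first components.\<close>

lemma set_sum_controlled:
  assumes f: "f \<in> bfun_set_sum U F1 F2" and M: "0 \<le> M" "\<And>u. u \<in> U \<Longrightarrow> norm (f u) \<le> M"
  obtains g h where "g \<in> F1" "h \<in> F2" "f = bfun_add U g h" "\<And>u. u \<in> U \<Longrightarrow> norm (g u) \<le> M"
proof -
  obtain g h where gh: "g \<in> F1" "h \<in> F2" "f = bfun_add U g h"
    using f by (auto simp: bfun_set_sum_def)
  define g' where "g' = compose U (radial_retraction M) g"
  have g'_app: "g' u = radial_retraction M (g u)" if "u \<in> U" for u
    using that by (simp add: g'_def compose_def)
  have g': "g' \<in> F1"
    unfolding g'_def using lipschitz_on_radial_retraction[OF M(1)] gh(1) by (rule F1_compose)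
  have d: "bfun_diff U g g' \<in> F2"
  proof (rule dominated)
    show "bfun_diff U g g' \<in> F1" using gh(1) g' by (rule F1_diff)
    show "h \<in> F2" by fact
    fix u assume u: "u \<in> U"
    \<comment> \<open>On \<open>U\<close>, \<open>g\<close> is \<open>f - h\<close>. The bound on
      \<open>f\<close> thus makes the excess of \<open>norm (g u)\<close> over \<open>M\<close> at
      most \<open>norm (h u)\<close>, and the value 0 of the maximum is harmless.\<close>
    have "norm (g u) \<le> norm (f u) + norm (h u)"
      using u gh(3) norm_triangle_ineq4[of "g u + h u" "h u"] by simp
    then have "norm (g u) - M \<le> norm (h u)"
      using M(2)[OF u] by linarith
    then show "norm (bfun_diff U g g' u) \<le> norm (h u)"
      using u by (simp add: g'_app norm_diff_radial_retraction[OF M(1)])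
  qed
  show thesis
  proof
    show "g' \<in> F1" by fact
    show "bfun_add U h (bfun_diff U g g') \<in> F2" using gh(2) d by (rule F2_add)
    show "f = bfun_add U g' (bfun_add U h (bfun_diff U g g'))"
      unfolding gh(3) by (rule extensionalityI[of _ U]) auto
    show "norm (g' u) \<le> M" if "u \<in> U" for u
      using that M(1) by (simp add: g'_app norm_radial_retraction_le)
  qed
qed

text \<open>The increments are decomposed with geometrically small first components, whose series
  converges uniformly to an element of \<open>F1\<close>. The second components need no bound of
  their own: their sums are \<open>f k\<close> minus the first partial sums, hence converge as
  well.\<close>

lemma rapidly_Cauchy_limit_mem:
  assumes f: "\<And>k. f k \<in> bfun_set_sum U F1 F2"
    and step: "\<And>k u. u \<in> U \<Longrightarrow> norm (f (Suc k) u - f k u) \<le> (1/2) ^ k"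
    and lim: "uniform_limit U f l sequentially" and l: "l \<in> extensional U"
  shows "l \<in> bfun_set_sum U F1 F2"
proof -
  have "\<exists>g h. g \<in> F1 \<and> h \<in> F2 \<and> bfun_diff U (f (Suc k)) (f k) = bfun_add U g h
      \<and> (\<forall>u\<in>U. norm (g u) \<le> (1/2) ^ k)" for k
    by (rule set_sum_controlled[OF set_sum_diff[OF f f], of "(1/2) ^ k" "Suc k" k])
      (use step in auto)
  then obtain g h where g: "\<And>k. g k \<in> F1" and h: "\<And>k. h k \<in> F2"
    and gh: "\<And>k. bfun_diff U (f (Suc k)) (f k) = bfun_add U (g k) (h k)"
    and g_le: "\<And>k u. u \<in> U \<Longrightarrow> norm (g k u) \<le> (1/2) ^ k"
    by metis
  obtain g0 h0 where g0: "g0 \<in> F1" and h0: "h0 \<in> F2" and f0: "f 0 = bfun_add U g0 h0"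
    using f[of 0] by (auto simp: bfun_set_sum_def)
  \<comment> \<open>\<open>G k\<close> is the first component of \<open>f k\<close> obtained by
    telescoping from an arbitrary decomposition of \<open>f 0\<close>.\<close>
  define G where "G k = (\<lambda>u\<in>U. g0 u + (\<Sum>j<k. g j u))" for k
  have G_Suc: "G (Suc k) = bfun_add U (G k) (g k)" for k
    by (rule extensionalityI[of _ U]) (auto simp: G_def)
  have G_0: "G 0 = g0"
    using g0 F1_bfun by (intro extensionalityI[of _ U]) (auto simp: G_def bfun_def)
  have G_mem: "G k \<in> F1" for k
    by (induction k) (auto simp: G_0 G_Suc g0 g intro: F1_add)
  have H_mem: "bfun_diff U (f k) (G k) \<in> F2" for k
  proof (induction k)
    case 0
    have "bfun_diff U (f 0) (G 0) = h0"
      using h0 F2_bfun by (intro extensionalityI[of _ U]) (auto simp: G_0 f0 bfun_def)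
    with h0 show ?case by simp
  next
    case (Suc k)
    \<comment> \<open>Passing to \<open>Suc k\<close> adds \<open>g k + h k\<close> to
      \<open>f k\<close> and \<open>g k\<close> to \<open>G k\<close>, so the remainder grows by
      \<open>h k\<close>.\<close>
    have "bfun_diff U (f (Suc k)) (G (Suc k)) = bfun_add U (bfun_diff U (f k) (G k)) (h k)"
    proof (rule extensionalityI[of _ U])
      fix u assume u: "u \<in> U"
      then show "bfun_diff U (f (Suc k)) (G (Suc k)) u
          = bfun_add U (bfun_diff U (f k) (G k)) (h k) u"
        using fun_cong[OF gh[of k], of u] by (simp add: G_Suc algebra_simps)
    qed auto
    with Suc h show ?case by (simp add: F2_add)
  qed
  define Gl where "Gl = (\<lambda>u\<in>U. g0 u + (\<Sum>j. g j u))"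
  \<comment> \<open>The Weierstrass test with majorants \<open>(1/2) ^ k\<close> uses completeness
    of the value space.\<close>
  have "uniform_limit U (\<lambda>k u. g0 u + (\<Sum>j<k. g j u)) (\<lambda>u. g0 u + (\<Sum>j. g j u)) sequentially"
    by (intro uniform_limit_intros Weierstrass_m_test[where M = "\<lambda>k. (1/2) ^ k"] g_le
        summable_geometric) auto
  then have G_lim: "uniform_limit U G Gl sequentially"
    by (rule uniform_limit_cong'[THEN iffD1, rotated 2]) (auto simp: G_def Gl_def)
  have "Gl \<in> F1"
    using F1_closed G_mem _ G_lim by (rule closedin_uniform_limit_mem) (simp add: Gl_def)
  moreover have "bfun_diff U l Gl \<in> F2"
    using F2_closed H_mem
  proof (rule closedin_uniform_limit_mem)
    have "uniform_limit U (\<lambda>k u. f k u - G k u) (\<lambda>u. l u - Gl u) sequentially"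
      using lim G_lim by (intro uniform_limit_intros)
    then show "uniform_limit U (\<lambda>k. bfun_diff U (f k) (G k)) (bfun_diff U l Gl) sequentially"
      by (rule uniform_limit_cong'[THEN iffD1, rotated 2]) auto
  qed simp
  moreover have "l = bfun_add U Gl (bfun_diff U l Gl)"
    using l by (intro extensionalityI[of _ U]) auto
  ultimately show ?thesis
    unfolding bfun_set_sum_def by blast
qed

lemma mcomplete_set_sum:
  "Metric_space.mcomplete (bfun_set_sum U F1 F2)
    (norm_dist (bfun_set_sum U F1 F2) (bfun_diff U) (sup_norm U))"
proof -
  let ?V = "bfun_set_sum U F1 F2"
  interpret Metric_space ?V "norm_dist ?V (bfun_diff U) (sup_norm U)"
    using set_sum_bfun by (rule Metric_space_sup_norm)
  show ?thesis
    unfolding mcomplete_def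
  proof (intro allI impI)
    fix \<sigma> assume \<sigma>: "MCauchy \<sigma>"
    then have mem: "\<sigma> n \<in> ?V" for n
      unfolding MCauchy_def by blast
    have Cau: "uniformly_Cauchy_on U \<sigma>"
      using set_sum_bfun \<sigma> by (rule uniformly_Cauchy_on_if_MCauchy)
    then obtain l' where l': "uniform_limit U \<sigma> l' sequentially"
      using Cauchy_uniformly_convergent unfolding uniformly_convergent_on_def by blast
    \<comment> \<open>The limit provided by completeness is arbitrary off \<open>U\<close>;
      restriction makes it extensional.\<close>
    define l where "l = restrict l' U"
    have lim: "uniform_limit U \<sigma> l sequentially"
      using l' by (rule uniform_limit_cong'[THEN iffD1, rotated 2]) (auto simp: l_def)
    have "\<exists>N. \<forall>u\<in>U. \<forall>m\<ge>N. \<forall>n\<ge>N. dist (\<sigma> m u) (\<sigma> n u) < (1/2) ^ k" for k :: nat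
      using Cau unfolding uniformly_Cauchy_on_def by simp
    then obtain N where
      N: "\<And>k u m n. u \<in> U \<Longrightarrow> N k \<le> m \<Longrightarrow> N k \<le> n \<Longrightarrow> dist (\<sigma> m u) (\<sigma> n u) < (1/2) ^ k"
      by metis
    \<comment> \<open>The sum puts both \<open>r k\<close> and \<open>r (Suc k)\<close> beyond
      \<open>N k\<close>, as the increment bound requires; the summand \<open>k\<close> makes
      \<open>r\<close> tend to infinity.\<close>
    define r where "r k = k + (\<Sum>j\<le>k. N j)" for k
    have N_le: "N k \<le> r k" "N k \<le> r (Suc k)" for k
      unfolding r_def by (intro trans_le_add2 member_le_sum; simp)+
    have "filterlim r at_top sequentially"
      by (rule filterlim_at_top_mono[OF filterlim_ident]) (simp add: r_def)
    then have "uniform_limit U (\<lambda>k. \<sigma> (r k)) l sequentially"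
      using lim by (rule filterlim_compose[rotated])
    then have "l \<in> ?V"
    proof (rule rapidly_Cauchy_limit_mem[rotated 2])
      show "\<sigma> (r k) \<in> ?V" for k by (rule mem)
      show "norm (\<sigma> (r (Suc k)) u - \<sigma> (r k) u) \<le> (1/2) ^ k" if "u \<in> U" for k u
        using N[OF that N_le(2) N_le(1)] by (simp add: dist_norm less_imp_le)
      show "l \<in> extensional U" by (simp add: l_def)
    qed
    \<comment> \<open>The subsequence serves only to place \<open>l\<close> in the sum; the whole
      sequence is already known to converge uniformly to it.\<close>
    then show "\<exists>l. limitin mtopology \<sigma> l sequentially"
      using limitin_if_uniform_limit[OF set_sum_bfun mem _ lim] by blast
  qed
qed

end

section \<open>The Banach space axioms for the sum\<close>

theorem theorem4p1:
  fixes U :: "'u set"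
    and smul :: "'k::real_normed_field \<Rightarrow> 'x::banach \<Rightarrow> 'x"
    and F1 F2 :: "('u \<Rightarrow> 'x) set"
  assumes "vector_space smul"
    and "\<And>a x. norm (smul a x) = norm a * norm x"
    and "closed_vector_subspace smul U F1"
    and "closed_vector_subspace smul U F2"
    and "\<And>\<Phi> L f. L-lipschitz_on UNIV \<Phi> \<Longrightarrow> f \<in> F1 \<Longrightarrow> compose U \<Phi> f \<in> F1"
    and "\<And>g h. g \<in> F1 \<Longrightarrow> h \<in> F2 \<Longrightarrow> (\<And>u. u \<in> U \<Longrightarrow> norm (g u) \<le> norm (h u)) \<Longrightarrow> g \<in> F2"
  shows "banach_space_on (bfun_set_sum U F1 F2) (bfun_add U) (bfun_zero U)
           (bfun_scale smul U) (sup_norm U)"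
proof -
  interpret vector_space smul by fact
  let ?V = "bfun_set_sum U F1 F2"
  note F1 = assms(3)[unfolded closed_vector_subspace_def]
  note F2 = assms(4)[unfolded closed_vector_subspace_def]
  \<comment> \<open>Bridges the subtraction written with \<open>smul\<close> in
    \<open>banach_space_on\<close> and the scalar-free one in the metric lemmas; it also gives
    closure of \<open>F1\<close> and \<open>F2\<close> under differences.\<close>
  have diff: "bfun_add U f (bfun_scale smul U (- 1) g) = bfun_diff U f g" for f g
    by (rule extensionalityI[of _ U]) auto
  interpret two_subspaces U F1 F2
  proof
    show "bfun_diff U f g \<in> F1" if "f \<in> F1" "g \<in> F1" for f g
      using F1 that by (metis diff)
    show "bfun_diff U f g \<in> F2" if "f \<in> F2" "g \<in> F2" for f g
      using F2 that by (metis diff)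
  qed (use F1 F2 assms(5,6) in blast)+
  have ext: "f \<in> extensional U" if "f \<in> ?V" for f
    using that set_sum_bfun by (auto simp: bfun_def)
  have zero: "bfun_zero U \<in> ?V"
  proof -
    have "bfun_zero U = bfun_add U (bfun_zero U) (bfun_zero U)"
      by (rule extensionalityI[of _ U]) auto
    with F1 F2 show ?thesis unfolding bfun_set_sum_def by blast
  qed
  have scale: "bfun_scale smul U a f \<in> ?V" if f: "f \<in> ?V" for a f
  proof -
    obtain g h where gh: "g \<in> F1" "h \<in> F2" "f = bfun_add U g h"
      using f by (auto simp: bfun_set_sum_def)
    have "bfun_scale smul U a f = bfun_add U (bfun_scale smul U a g) (bfun_scale smul U a h)"
      unfolding gh(3) by (rule extensionalityI[of _ U]) (auto simp: scale_right_distrib)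
    with F1 F2 gh show ?thesis unfolding bfun_set_sum_def by blast
  qed
  show ?thesis
  proof
    show "bfun_zero U \<in> ?V" by (rule zero)
    show "Metric_space.mcomplete ?V
        (norm_dist ?V (\<lambda>x y. bfun_add U x (bfun_scale smul U (- 1) y)) (sup_norm U))"
      using mcomplete_set_sum by (simp add: diff)
  next
    fix f f' assume f: "f \<in> ?V" "f' \<in> ?V"
    obtain g h g' h' where gh: "g \<in> F1" "h \<in> F2" "g' \<in> F1" "h' \<in> F2"
      and eq: "f = bfun_add U g h" "f' = bfun_add U g' h'"
      using f by (auto simp: bfun_set_sum_def)
    have "bfun_add U f f' = bfun_add U (bfun_add U g g') (bfun_add U h h')"
      unfolding eq by (rule extensionalityI[of _ U]) auto
    with gh show "bfun_add U f f' \<in> ?V"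
      by (auto simp: bfun_set_sum_def intro: F1_add F2_add)
    show "sup_norm U (bfun_add U f f') \<le> sup_norm U f + sup_norm U f'"
      using f set_sum_bfun by (intro sup_norm_triangle) auto
  next
    fix f a assume f: "f \<in> ?V"
    show "bfun_scale smul U a f \<in> ?V" using f by (rule scale)
    show "\<exists>g\<in>?V. bfun_add U f g = bfun_zero U"
    proof
      show "bfun_add U f (bfun_scale smul U (- 1) f) = bfun_zero U"
        by (rule extensionalityI[of _ U]) auto
    qed (rule scale[OF f])
    show "0 \<le> sup_norm U f"
      using f set_sum_bfun by (intro sup_norm_nonneg) auto
    show "sup_norm U f = 0 \<longleftrightarrow> f = bfun_zero U"
      using f set_sum_bfun by (intro sup_norm_eq_0_iff) auto
    show "sup_norm U (bfun_scale smul U a f) = norm a * sup_norm U f"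
      using assms(2) f set_sum_bfun by (intro sup_norm_scale) auto
  \<comment> \<open>The remaining algebraic laws hold pointwise on \<open>U\<close>. Where one side
    is a bare member of the sum, as in \<open>add_zero\<close> and \<open>scale_one\<close>,
    \<open>ext\<close> supplies its extensionality.\<close>
  qed (auto intro!: extensionalityI[of _ U] simp: ext algebra_simps scale_right_distrib scale_left_distrib)
qed

end
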